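(* Let $n$ be a positive integer and let $G$ be a finite $(n+2)$-centralizer group of conjugate type $(n,1)$. Then $G$ is a CA-group and $G/Z(G)$ is elementary abelian of order $n^2$.
   Context: $\mathrm{Cent}(G)=\{C_G(x): x\in G\}$ is the set of centralizers of elements of $G$; $G$ is $m$-centralizer if $|\mathrm{Cent}(G)|=m$. A finite group $G$ is of conjugate type $(n,1)$ if every proper element centralizer (i.e. $C_G(x)$ for $x\in G\setminus Z(G)$) has index $n$ in $G$. A group is a CA-group if the centralizer of every non-central element is abelian. *)

theory Defs
  imports "HOL-Algebra.Coset" "HOL-Computational_Algebra.Primes"
begin

definition centralizer :: "('a, 'b) monoid_scheme \<Rightarrow> 'a \<Rightarrow> 'a set" where
  "centralizer G x = {y \<in> carrier G. y \<otimes>\<^bsub>G\<^esub> x = x \<otimes>\<^bsub>G\<^esub> y}"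

definition center :: "('a, 'b) monoid_scheme \<Rightarrow> 'a set" where
  "center G = {z \<in> carrier G. \<forall>x \<in> carrier G. z \<otimes>\<^bsub>G\<^esub> x = x \<otimes>\<^bsub>G\<^esub> z}"

text \<open>The set of centralizers, in which equal centralizers of different elements count once.\<close>

definition Cent :: "('a, 'b) monoid_scheme \<Rightarrow> 'a set set" where
  "Cent G = centralizer G ` carrier G"

definition centralizer_group :: "nat \<Rightarrow> ('a, 'b) monoid_scheme \<Rightarrow> bool" where
  "centralizer_group m G \<longleftrightarrow> group G \<and> finite (Cent G) \<and> card (Cent G) = m"

text \<open>Conjugate type \<open>(n, 1)\<close>: all centralizers of non-central elements have index \<open>n\<close>.
  The condition holds vacuously when \<open>G\<close> is abelian.\<close>

definition conjugate_type_1 :: "nat \<Rightarrow> ('a, 'b) monoid_scheme \<Rightarrow> bool" where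
  "conjugate_type_1 n G \<longleftrightarrow> group G \<and> finite (carrier G) \<and>
     (\<forall>x \<in> carrier G - center G. card (rcosets\<^bsub>G\<^esub> (centralizer G x)) = n)"

definition CA_group :: "('a, 'b) monoid_scheme \<Rightarrow> bool" where
  "CA_group G \<longleftrightarrow> group G \<and>
     (\<forall>x \<in> carrier G - center G. comm_group (G\<lparr>carrier := centralizer G x\<rparr>))"

text \<open>Elementary abelian groups: abelian \<open>p\<close>-groups of exponent dividing \<open>p\<close>,
  for some prime \<open>p\<close>. The trivial group is included.\<close>

definition elementary_abelian :: "('a, 'b) monoid_scheme \<Rightarrow> bool" where
  "elementary_abelian G \<longleftrightarrow> comm_group G \<and>
     (\<exists>p::nat. prime p \<and> (\<forall>x \<in> carrier G. x [^]\<^bsub>G\<^esub> p = \<one>\<^bsub>G\<^esub>))"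

lemma (in group) subgroup_centralizer:
  assumes x: "x \<in> carrier G"
  shows "subgroup (centralizer G x) G"
proof (rule subgroupI)
  show "centralizer G x \<noteq> {}"
    using x by (auto simp: centralizer_def)
next
  fix a assume a: "a \<in> centralizer G x"
  then have ac: "a \<in> carrier G" and eq: "a \<otimes> x = x \<otimes> a"
    by (auto simp: centralizer_def)
  have "inv a \<otimes> x = inv a \<otimes> (x \<otimes> a) \<otimes> inv a"
    using ac x by (simp add: m_assoc)
  also have "\<dots> = x \<otimes> inv a"
    using ac x by (simp add: eq[symmetric] m_assoc[symmetric])
  finally show "inv a \<in> centralizer G x"
    using ac by (simp add: centralizer_def)
next
  fix a b assume "a \<in> centralizer G x" "b \<in> centralizer G x"
  then show "a \<otimes> b \<in> centralizer G x"
    using x by (simp add: centralizer_def) (metis m_assoc)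
qed (auto simp: centralizer_def)

lemma (in group) center_eq_Inter: "center G = (\<Inter>x \<in> carrier G. centralizer G x)"
  using one_closed by (auto simp: center_def centralizer_def)

lemma (in group) normal_center: "center G \<lhd> G"
proof -
  have "subgroup (center G) G"
    unfolding center_eq_Inter
    by (rule subgroups_Inter) (auto intro: subgroup_centralizer)
  moreover have "x \<otimes> h \<otimes> inv x \<in> center G"
    if "x \<in> carrier G" "h \<in> center G" for x h
  proof -
    have "h \<in> carrier G" "x \<otimes> h = h \<otimes> x"
      using that by (auto simp: center_def)
    then have "x \<otimes> h \<otimes> inv x = h"
      using that(1) by (simp add: m_assoc)
    then show ?thesis using that(2) by simp
  qed
  ultimately show ?thesis
    by (simp add: normal_inv_iff)
qed

end

theory Submission
  imports Defs "HOL-Algebra.Multiplicative_Group"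
begin

text \<open>The \<open>n + 1\<close> proper centralizers have order \<open>c = |G| / n\<close> and cover \<open>G\<close>. As any two of them
  meet in at least \<open>c / n\<close> elements, a fixed one together with the parts of the other \<open>n\<close> outside it
  accounts for at most \<open>c + n (c - c / n) = |G|\<close> elements. So equality holds throughout: any two
  proper centralizers have product \<open>G\<close>, and their intersection lies in all the others, hence is the
  center. Thus an element outside the center lies in only one proper centralizer, which gives the
  CA property, and the images of the proper centralizers partition \<open>G / Z(G)\<close> like the lines
  through the origin of an affine plane of order \<open>n\<close>. As for translation planes, this
  forces the group to be elementary abelian.\<close>

section \<open>Products of subgroups\<close>

text \<open>Multiplication maps \<open>H \<times> K\<close> onto \<open>H <#> K\<close>, and each
  fibre is a copy of \<open>H \<inter> K\<close>; the product set need not be a subgroup.\<close>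

lemma (in group) card_set_mult_inter:
  assumes fin: "finite (carrier G)" and H: "subgroup H G" and K: "subgroup K G"
  shows "card (H <#> K) * card (H \<inter> K) = card H * card K"
proof -
  interpret H: subgroup H G by fact
  interpret K: subgroup K G by fact
  have finHK: "finite (H \<times> K)"
    using fin H.subset K.subset by (auto intro: finite_subset)
  have img: "H <#> K = (\<lambda>(h, k). h \<otimes> k) ` (H \<times> K)"
    by (auto simp: set_mult_def image_iff)
  have fibre: "card {p \<in> H \<times> K. (\<lambda>(h, k). h \<otimes> k) p = g} = card (H \<inter> K)"
    if "g \<in> H <#> K" for g
  proof -
    obtain h k where hk: "h \<in> H" "k \<in> K" "g = h \<otimes> k"
      using \<open>g \<in> H <#> K\<close> by (auto simp: set_mult_def)
    have cancel: "d \<otimes> (inv d \<otimes> k) = k" if "d \<in> H" for d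
      using that hk by (simp add: m_assoc[symmetric])
    \<comment> \<open>Two factorisations of \<open>g\<close> differ by moving some \<open>d\<close>
      from the right factor to the left; \<open>d\<close> is recovered from the first component, and
      it lies in \<open>K\<close> as well because
      \<open>h' \<otimes> k' = h \<otimes> k\<close>.\<close>
    have "bij_betw (\<lambda>d. (h \<otimes> d, inv d \<otimes> k)) (H \<inter> K) {p \<in> H \<times> K. (\<lambda>(h, k). h \<otimes> k) p = g}"
    proof (rule bij_betwI[where g = "\<lambda>p. inv h \<otimes> fst p"])
      show "(\<lambda>d. (h \<otimes> d, inv d \<otimes> k)) \<in> H \<inter> K \<rightarrow> {p \<in> H \<times> K. (\<lambda>(h, k). h \<otimes> k) p = g}"
        using hk cancel by (auto simp: m_assoc)
      have "inv h \<otimes> h' = k \<otimes> inv k'" if "h' \<in> H" "k' \<in> K" "h' \<otimes> k' = h \<otimes> k" for h' k'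
      proof -
        have "h' = h \<otimes> k \<otimes> inv k'"
          using that hk by (metis H.mem_carrier K.mem_carrier inv_solve_right m_closed)
        then show ?thesis using that hk by (simp add: m_assoc[symmetric])
      qed
      note eq = this
      then show "(\<lambda>p. inv h \<otimes> fst p) \<in> {p \<in> H \<times> K. (\<lambda>(h, k). h \<otimes> k) p = g} \<rightarrow> H \<inter> K"
        using hk by (auto simp: Pi_iff)
      show "inv h \<otimes> fst (h \<otimes> d, inv d \<otimes> k) = d" if "d \<in> H \<inter> K" for d
        using that hk by (simp add: m_assoc[symmetric])
      show "(h \<otimes> (inv h \<otimes> fst p), inv (inv h \<otimes> fst p) \<otimes> k) = p"
        if p: "p \<in> {p \<in> H \<times> K. (\<lambda>(h, k). h \<otimes> k) p = g}" for p
      proof -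
        obtain h' k' where p': "p = (h', k')" "h' \<in> H" "k' \<in> K" "h' \<otimes> k' = h \<otimes> k"
          using p hk by (cases p) auto
        have "h \<otimes> (inv h \<otimes> h') = h'"
          using p' hk by (simp add: m_assoc[symmetric])
        moreover have "inv (inv h \<otimes> h') \<otimes> k = k'"
          using p' hk eq[OF p'(2,3,4)] by (simp add: inv_mult_group m_assoc)
        ultimately show ?thesis using p' by simp
      qed
    qed
    then show ?thesis by (simp add: bij_betw_same_card)
  qed
  have "card H * card K = (\<Sum>p\<in>H \<times> K. 1)"
    by (simp add: card_cartesian_product)
  also have "\<dots> = (\<Sum>g\<in>H <#> K. card {p \<in> H \<times> K. (\<lambda>(h, k). h \<otimes> k) p = g})"
    using sum.image_gen[OF finHK, of "\<lambda>_. 1::nat" "\<lambda>(h, k). h \<otimes> k"] by (simp add: img)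
  also have "\<dots> = card (H <#> K) * card (H \<inter> K)"
    using fibre by simp
  finally show ?thesis by simp
qed

text \<open>Carries equations such as \<open>A <#> B = carrier G\<close> over to a quotient.\<close>

lemma (in group_hom) image_set_mult:
  assumes "A \<subseteq> carrier G" "B \<subseteq> carrier G"
  shows "h ` A <#>\<^bsub>H\<^esub> h ` B = h ` (A <#>\<^bsub>G\<^esub> B)"
proof -
  have "(\<Union>x\<in>A. \<Union>y\<in>B. {h x \<otimes>\<^bsub>H\<^esub> h y}) = (\<Union>x\<in>A. \<Union>y\<in>B. {h (x \<otimes>\<^bsub>G\<^esub> y)})"
    using assms by (intro SUP_cong refl) (auto simp: subset_iff)
  then show ?thesis by (simp add: set_mult_def image_UN)
qed

section \<open>Coverings by \<open>n + 1\<close> subgroups of index \<open>n\<close>\<close>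

text \<open>Isolates what the counting uses about the proper centralizers. With \<open>n + 1\<close>
  members, fixing one leaves exactly \<open>n\<close> others, which is what makes the estimates
  tight.\<close>

locale index_cover = group +
  fixes F :: "'a set set" and n :: nat
  assumes fin: "finite (carrier G)"
    and sub: "\<And>A. A \<in> F \<Longrightarrow> subgroup A G"
    and index: "\<And>A. A \<in> F \<Longrightarrow> card (rcosets A) = n"
    and card_F: "card F = n + 1"
    and cover: "\<Union>F = carrier G"
begin

lemma finite_F: "finite F"
  using card_F by (simp add: card_ge_0_finite)

lemma subset_carrier: "A \<in> F \<Longrightarrow> A \<subseteq> carrier G"
  using sub subgroup.subset by blast

lemma finite_member: "A \<in> F \<Longrightarrow> finite A"
  using fin subset_carrier finite_subset by blast

lemma card_member: "A \<in> F \<Longrightarrow> n * card A = order G"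
  using lagrange[OF sub] index by (simp add: mult.commute)

lemma n_pos: "n > 0"
proof -
  obtain A where "A \<in> F" using card_F by fastforce
  then show ?thesis
    using card_member order_gt_0_iff_finite fin by (metis mult_0 neq0_conv)
qed

lemma card_member_eq: "A \<in> F \<Longrightarrow> B \<in> F \<Longrightarrow> card A = card B"
  using card_member[of A] card_member[of B] n_pos by (metis mult_cancel1 neq0_conv)

text \<open>The product formula with \<open>card A = card B\<close> and
  \<open>card (A <#> B) \<le> order G = n * card A\<close>, after cancelling \<open>card A\<close>
  twice.\<close>

lemma card_inter_ge:
  assumes "A \<in> F" "B \<in> F"
  shows "card A \<le> n * card (A \<inter> B)"
proof -
  have "card (A <#> B) \<le> n * card A"
    using assms card_member fin set_mult_closed subset_carrier
    by (metis card_mono order_def)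
  then have "card A * card A \<le> n * card A * card (A \<inter> B)"
    using card_set_mult_inter[OF fin sub sub, of A B] assms card_member_eq[of A B]
    by (metis mult_le_mono1)
  moreover have "card A > 0"
    using assms finite_member subgroup.one_closed[OF sub] by (auto simp: card_gt_0_iff)
  ultimately show ?thesis by (simp add: mult.assoc mult.left_commute)
qed

text \<open>By \<open>card_inter_ge\<close>, \<open>B - A\<close> takes up at most one
  \<open>n\<close>-th of the complement of \<open>A\<close>; scaling by \<open>n\<close> avoids
  division.\<close>

lemma card_diff_le:
  assumes "A \<in> F" "B \<in> F"
  shows "n * card (B - A) \<le> card (carrier G - A)"
proof -
  have "card (B - A) = card A - card (A \<inter> B)"
    using assms finite_member card_member_eq
    by (metis Int_commute card_Diff_subset_Int finite_Int)
  moreover have "card (carrier G - A) = n * card A - card A"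
    using assms finite_member subset_carrier card_member by (simp add: card_Diff_subset order_def)
  ultimately show ?thesis
    using card_inter_ge[OF assms] by (simp add: diff_mult_distrib2)
qed

lemma sum_card_diff_le:
  assumes "A \<in> F"
  shows "(\<Sum>B\<in>F - {A}. card (B - A)) \<le> card (carrier G - A)"
proof -
  have "n * (\<Sum>B\<in>F - {A}. card (B - A)) \<le> (\<Sum>B\<in>F - {A}. card (carrier G - A))"
    unfolding sum_distrib_left using assms by (intro sum_mono card_diff_le) auto
  also have "\<dots> = n * card (carrier G - A)"
    using assms card_F finite_F by simp
  finally show ?thesis using n_pos by simp
qed

text \<open>The \<open>n\<close> differences cover the complement of \<open>A\<close>, and each has
  at most an \<open>n\<close>-th of its size; a deficit in a single one would leave a point
  uncovered.\<close>

lemma card_diff_eq: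
  assumes "A \<in> F" "B \<in> F" "A \<noteq> B"
  shows "n * card (B - A) = card (carrier G - A)"
proof (rule antisym[OF card_diff_le], rule assms, rule assms, rule ccontr)
  assume less: "\<not> card (carrier G - A) \<le> n * card (B - A)"
  have "carrier G - A \<subseteq> (\<Union>D\<in>F - {A}. D - A)"
    using cover by auto
  then have "card (carrier G - A) \<le> card (\<Union>D\<in>F - {A}. D - A)"
    using finite_F finite_member by (intro card_mono) auto
  also have "\<dots> \<le> (\<Sum>D\<in>F - {A}. card (D - A))"
    using finite_F by (intro card_UN_le) auto
  finally have "n * card (carrier G - A) \<le> (\<Sum>D\<in>F - {A}. n * card (D - A))"
    by (simp flip: sum_distrib_left)
  also have "\<dots> < (\<Sum>D\<in>F - {A}. card (carrier G - A))"
    using assms finite_F less card_diff_le by (intro sum_strict_mono_ex1) (auto intro!: bexI[of _ B])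
  also have "\<dots> = n * card (carrier G - A)"
    using assms card_F finite_F by simp
  finally show False by simp
qed

text \<open>Splitting \<open>B\<close> and \<open>G\<close> along \<open>A\<close> and scaling the
  first count by \<open>n\<close> gives two expressions for \<open>n * card A\<close>; by
  \<open>card_diff_eq\<close> the parts outside \<open>A\<close> cancel.\<close>

lemma card_inter:
  assumes "A \<in> F" "B \<in> F" "A \<noteq> B"
  shows "n * card (A \<inter> B) = card A"
proof -
  have "card A = card (A \<inter> B) + card (B - A)"
    using assms finite_member card_member_eq
    by (metis Int_commute card_Int_Diff)
  then have "n * card A = n * card (A \<inter> B) + n * card (B - A)"
    by (simp add: distrib_left)
  moreover have "n * card A = card A + card (carrier G - A)"
    using assms fin subset_carrier card_member
    by (metis Int_absorb1 card_Int_Diff order_def)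
  ultimately show ?thesis
    using card_diff_eq[OF assms] by simp
qed

lemma set_mult_eq_carrier:
  assumes "A \<in> F" "B \<in> F" "A \<noteq> B"
  shows "A <#> B = carrier G"
proof (rule card_subset_eq[OF fin])
  show "A <#> B \<subseteq> carrier G"
    using assms by (simp add: set_mult_closed subset_carrier)
  have "card (A <#> B) * card (A \<inter> B) = card A * card B"
    using assms by (simp add: card_set_mult_inter fin sub)
  also have "\<dots> = n * card A * card (A \<inter> B)"
    using card_inter[OF assms] card_member_eq[of A B] assms by (metis mult.assoc mult.commute)
  finally have "card (A <#> B) * card (A \<inter> B) = n * card A * card (A \<inter> B)" .
  moreover have "\<one> \<in> A \<inter> B" "finite (A \<inter> B)"
    using assms finite_member sub subgroup.one_closed by auto
  then have "card (A \<inter> B) \<noteq> 0" by auto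
  ultimately show "card (A <#> B) = card (carrier G)"
    using assms card_member by (simp add: order_def)
qed

text \<open>A point of \<open>A \<inter> B\<close> outside \<open>C\<close> would be covered twice,
  although the sets \<open>D - C\<close> have together no more elements than the complement of
  \<open>C\<close> which they cover.\<close>

lemma inter_subset:
  assumes "A \<in> F" "B \<in> F" "A \<noteq> B" "C \<in> F"
  shows "A \<inter> B \<subseteq> C"
proof (rule ccontr)
  assume "\<not> A \<inter> B \<subseteq> C"
  then obtain x where x: "x \<in> A" "x \<in> B" "x \<notin> C" by auto
  \<comment> \<open>Removing \<open>x\<close> from \<open>A\<close> alone keeps the covering, since
    \<open>B\<close> still contains \<open>x\<close>, but lowers the total count.\<close>
  define f where "f D = (if D = A then D - C - {x} else D - C)" for D
  have "carrier G - C \<subseteq> (\<Union>D\<in>F - {C}. f D)"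
  proof
    fix y assume y: "y \<in> carrier G - C"
    show "y \<in> (\<Union>D\<in>F - {C}. f D)"
    proof (cases "y = x")
      case True
      then show ?thesis using assms x by (auto simp: f_def intro!: bexI[of _ B])
    next
      case False
      obtain D where "D \<in> F" "y \<in> D" using y cover by auto
      then show ?thesis using y False by (auto simp: f_def intro!: bexI[of _ D])
    qed
  qed
  then have "card (carrier G - C) \<le> card (\<Union>D\<in>F - {C}. f D)"
    using finite_F finite_member by (intro card_mono) (auto simp: f_def)
  also have "\<dots> \<le> (\<Sum>D\<in>F - {C}. card (f D))"
    using finite_F by (intro card_UN_le) auto
  also have "\<dots> < (\<Sum>D\<in>F - {C}. card (D - C))"
  proof (rule sum_strict_mono_ex1)
    have "card (f A) < card (A - C)"
      using x finite_member[OF assms(1)] by (intro psubset_card_mono) (auto simp: f_def)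
    then show "\<exists>D\<in>F - {C}. card (f D) < card (D - C)"
      using assms x by auto
  qed (auto simp: f_def finite_F finite_member intro!: card_mono)
  finally show False
    using sum_card_diff_le[OF assms(4)] by simp
qed

lemma inter_eq_Inter:
  assumes "A \<in> F" "B \<in> F" "A \<noteq> B"
  shows "A \<inter> B = \<Inter>F"
  using assms inter_subset[OF assms] by blast

end

section \<open>Partitions with transversal components\<close>

text \<open>The congruence partition of a translation plane: components are the lines through the
  origin, and \<open>transversal\<close> says that cosets of different components meet.
  \<open>proper\<close> excludes the partition with \<open>carrier G\<close> as its only
  component.\<close>

locale transversal_partition = group +
  fixes P :: "'a set set"
  assumes fin: "finite (carrier G)"
    and sub: "\<And>A. A \<in> P \<Longrightarrow> subgroup A G"
    and cover: "\<Union>P = carrier G"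
    and proper: "carrier G \<notin> P"
    and disjoint: "\<And>A B. A \<in> P \<Longrightarrow> B \<in> P \<Longrightarrow> A \<noteq> B \<Longrightarrow> A \<inter> B = {\<one>}"
    and transversal: "\<And>A B. A \<in> P \<Longrightarrow> B \<in> P \<Longrightarrow> A \<noteq> B \<Longrightarrow> A <#> B = carrier G"
begin

lemma subset_carrier: "A \<in> P \<Longrightarrow> A \<subseteq> carrier G"
  using sub subgroup.subset by blast

lemma ex_component: "x \<in> carrier G \<Longrightarrow> \<exists>A\<in>P. x \<in> A"
  using cover by auto

lemma ex_outside: "A \<in> P \<Longrightarrow> \<exists>x\<in>carrier G. x \<notin> A"
  using subset_carrier proper by (metis subsetI subset_antisym)

text \<open>If \<open>x a x\<inverse>\<close> lies in another component \<open>B\<close>, write \<open>x = b a'\<close> with \<open>a' \<in> A\<close> and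
  \<open>b \<in> B\<close>; then \<open>a' a a'\<inverse>\<close> lies in both components.\<close>

lemma component_normal:
  assumes A: "A \<in> P"
  shows "A \<lhd> G"
proof -
  interpret A: subgroup A G using A by (rule sub)
  have "x \<otimes> a \<otimes> inv x \<in> A" if x: "x \<in> carrier G" and a: "a \<in> A" for x a
  proof -
    obtain B where B: "B \<in> P" "x \<otimes> a \<otimes> inv x \<in> B"
      using ex_component x a by (metis A.mem_carrier inv_closed m_closed)
    interpret B: subgroup B G using B(1) by (rule sub)
    show ?thesis
    proof (cases "A = B")
      case True
      then show ?thesis using B(2) by metis
    next
      case False
      then have "B <#> A = carrier G"
        by (intro transversal B(1) A) simp
      then have "x \<in> B <#> A" using x by simp
      then obtain b a' where x_eq: "b \<in> B" "a' \<in> A" "x = b \<otimes> a'"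
        by (auto simp: set_mult_def)
      define d where "d = a' \<otimes> a \<otimes> inv a'"
      have "d \<in> A" using a x_eq by (simp add: d_def)
      \<comment> \<open>Undoing the conjugation by \<open>b\<close> inside \<open>B\<close> shows
        that \<open>d\<close> is in \<open>B\<close> too; in the order \<open>B <#> A\<close> the
        inner conjugation, by \<open>a'\<close>, stays inside \<open>A\<close>.\<close>
      then have "d = inv b \<otimes> (b \<otimes> d)"
        using x_eq(1) by (simp add: m_assoc[symmetric])
      also have "\<dots> = inv b \<otimes> (b \<otimes> d \<otimes> inv b) \<otimes> b"
        using x_eq(1) \<open>d \<in> A\<close> by (simp add: m_assoc)
      also have "b \<otimes> d \<otimes> inv b = x \<otimes> a \<otimes> inv x"
        using x_eq(1,2) a by (simp add: x_eq(3) d_def inv_mult_group m_assoc)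
      finally have "d \<in> B" using B(2) x_eq(1) by simp
      then have "d \<in> A \<inter> B" using \<open>d \<in> A\<close> by simp
      then have "d = \<one>" by (simp add: disjoint[OF A B(1) False])
      moreover have "a' \<otimes> a = d \<otimes> a'"
        using a x_eq(2) by (simp add: d_def m_assoc)
      ultimately have "a = \<one>"
        using a x_eq(2) by (simp add: l_cancel_one)
      then show ?thesis using x by simp
    qed
  qed
  then show ?thesis by (simp add: normal_inv_iff A.subgroup_axioms)
qed

text \<open>The component of \<open>b\<close> differs from \<open>A\<close>, both are normal, and
  the commutator of \<open>a\<close> and \<open>b\<close> lies in both: it is \<open>a\<close> times
  a conjugate of \<open>inv a\<close>, and a conjugate of \<open>b\<close> times
  \<open>inv b\<close>.\<close>

lemma commute_outside:
  assumes A: "A \<in> P" and a: "a \<in> A" and b: "b \<in> carrier G" "b \<notin> A"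
  shows "a \<otimes> b = b \<otimes> a"
proof -
  obtain B where B: "B \<in> P" "b \<in> B" using ex_component b by auto
  have "A \<noteq> B" using B b by auto
  interpret A: normal A G using A by (rule component_normal)
  interpret B: normal B G using B(1) by (rule component_normal)
  have ac: "a \<in> carrier G" using a by simp
  have "a \<otimes> (b \<otimes> inv a \<otimes> inv b) \<in> A"
    using a b by (simp add: A.inv_op_closed2)
  moreover have "(a \<otimes> b \<otimes> inv a) \<otimes> inv b \<in> B"
    using B ac by (simp add: B.inv_op_closed2)
  moreover have "a \<otimes> (b \<otimes> inv a \<otimes> inv b) = (a \<otimes> b \<otimes> inv a) \<otimes> inv b"
    using ac b by (simp add: m_assoc)
  ultimately have "a \<otimes> b \<otimes> inv a \<otimes> inv b = \<one>"
    using disjoint[OF A B(1) \<open>A \<noteq> B\<close>] by auto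
  then have "a \<otimes> b \<otimes> inv a = b"
    using ac b by (metis inv_closed inv_equality inv_inv m_closed)
  then show ?thesis
    using ac b by (metis inv_solve_right' m_closed)
qed

text \<open>For \<open>x\<close> and \<open>y\<close> in one component, take \<open>b\<close>
  outside it. Then \<open>y \<otimes> b\<close> is outside as well, and \<open>x\<close> commutes
  with both \<open>b\<close> and \<open>y \<otimes> b\<close>, hence with \<open>y\<close>.\<close>

lemma is_comm_group: "comm_group G"
proof (rule group_comm_groupI)
  fix x y assume x: "x \<in> carrier G" and y: "y \<in> carrier G"
  obtain A where A: "A \<in> P" "x \<in> A" using ex_component x by auto
  interpret A: subgroup A G using A(1) by (rule sub)
  show "x \<otimes> y = y \<otimes> x"
  proof (cases "y \<in> A")
    case False
    then show ?thesis using commute_outside A y by blast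
  next
    case True
    obtain b where b: "b \<in> carrier G" "b \<notin> A" using ex_outside A by auto
    have "y \<otimes> b \<notin> A"
      using True b
      by (metis A.m_closed A.m_inv_closed inv_closed inv_solve_left l_inv m_closed y)
    then have "x \<otimes> (y \<otimes> b) = y \<otimes> b \<otimes> x"
      using commute_outside[OF A] b y by simp
    also have "\<dots> = y \<otimes> x \<otimes> b"
      using commute_outside[OF A b] b x y by (simp add: m_assoc)
    finally have "x \<otimes> y \<otimes> b = y \<otimes> x \<otimes> b"
      using b x y by (simp add: m_assoc)
    then show ?thesis using b x y by simp
  qed
qed

text \<open>For \<open>b \<notin> A\<close>, the product \<open>a b\<close> lies in a third component, and \<open>(a b)\<^sup>p = b\<^sup>p\<close>.\<close>

lemma pow_outside:
  assumes A: "A \<in> P" and a: "a \<in> A" "a \<noteq> \<one>" "a [^] (p::nat) = \<one>"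
    and b: "b \<in> carrier G" "b \<notin> A"
  shows "b [^] p = \<one>"
proof -
  interpret comm_group G by (rule is_comm_group)
  interpret A: subgroup A G using A by (rule sub)
  obtain B where B: "B \<in> P" "b \<in> B" using ex_component b by auto
  interpret B: subgroup B G using B(1) by (rule sub)
  have pow_mem: "x [^] k \<in> D" if "D \<in> P" "x \<in> D" for D x and k :: nat
    using that sub by (induction k) (auto intro: subgroup.one_closed subgroup.m_closed)
  have ac: "a \<in> carrier G" using a by simp
  obtain C where C: "C \<in> P" "a \<otimes> b \<in> C" using ex_component b ac by (metis m_closed)
  \<comment> \<open>Otherwise \<open>a\<close>, the quotient of \<open>a \<otimes> b\<close> by
    \<open>b\<close>, would lie in \<open>B\<close> and be trivial.\<close>
  have "B \<noteq> C"
  proof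
    assume "B = C"
    then have "(a \<otimes> b) \<otimes> inv b \<in> B"
      using B(2) C(2) by (metis B.m_closed B.m_inv_closed)
    then have "a \<in> A \<inter> B" using ac a b by (simp add: m_assoc)
    then show False using disjoint[OF A B(1)] a B b by auto
  qed
  have "(a \<otimes> b) [^] p = b [^] p"
    using a(3) ac b by (simp add: pow_mult_distrib m_comm)
  moreover have "(a \<otimes> b) [^] p \<in> C" "b [^] p \<in> B"
    using B C by (simp_all add: pow_mem)
  ultimately show ?thesis
    using disjoint[OF B(1) C(1) \<open>B \<noteq> C\<close>] by auto
qed

text \<open>An element of prime order \<open>p\<close> forces exponent \<open>p\<close> outside its
  component by \<open>pow_outside\<close>; a second application, from an element outside, reaches
  that component itself.\<close>

lemma is_elementary_abelian: "elementary_abelian G"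
proof -
  obtain A0 where "A0 \<in> P" using cover one_closed by auto
  then obtain x where x: "x \<in> carrier G" "x \<notin> A0" using ex_outside by auto
  have "x \<noteq> \<one>" using x \<open>A0 \<in> P\<close> sub subgroup.one_closed by blast
  then have "ord x \<noteq> 1" using x ord_eq_1 by simp
  then obtain p where p: "prime p" "p dvd ord x" using prime_factor_nat by blast
  \<comment> \<open>This power of \<open>x\<close> has order \<open>p\<close>: it is nontrivial, as
    the exponent is positive and below \<open>ord x\<close>.\<close>
  define a where "a = x [^] (ord x div p)"
  have ac: "a \<in> carrier G" using x by (simp add: a_def)
  have "a [^] p = \<one>"
    using x p by (simp add: a_def nat_pow_pow pow_ord_eq_1)
  have "ord x > 0" using fin x ord_ge_1 by fastforce
  then have "0 < ord x div p" "ord x div p < ord x"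
    using p by (auto simp: dvd_div_eq_0_iff prime_gt_Suc_0_nat prime_gt_1_nat)
  then have "\<not> ord x dvd ord x div p" by (auto dest: dvd_imp_le)
  then have "a \<noteq> \<one>" using x by (simp add: a_def pow_eq_id)
  obtain A where A: "A \<in> P" "a \<in> A" using ex_component ac by auto
  note outside = pow_outside[OF A \<open>a \<noteq> \<one>\<close> \<open>a [^] p = \<one>\<close>]
  have "b [^] p = \<one>" if b: "b \<in> carrier G" for b
  proof (cases "b \<in> A")
    case False
    then show ?thesis by (rule outside[OF b])
  next
    case True
    \<comment> \<open>By \<open>outside\<close>, \<open>c\<close> can take over the role of
      \<open>a\<close>, with component \<open>C\<close>; only elements of
      \<open>A \<inter> C\<close>, which is trivial, escape both applications.\<close>
    obtain c where c: "c \<in> carrier G" "c \<notin> A" using ex_outside A by auto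
    obtain C where C: "C \<in> P" "c \<in> C" using ex_component c by auto
    have "c \<noteq> \<one>" using c A sub subgroup.one_closed by blast
    show ?thesis
    proof (cases "b \<in> C")
      case True
      then have "b = \<one>" using \<open>b \<in> A\<close> disjoint A C c by blast
      then show ?thesis by simp
    next
      case False
      then show ?thesis
        using pow_outside[OF C \<open>c \<noteq> \<one>\<close> outside] c b by blast
    qed
  qed
  then show ?thesis
    using is_comm_group p by (auto simp: elementary_abelian_def)
qed

end

section \<open>From the covering to a partition of the quotient\<close>

text \<open>Any two members meet exactly in the kernel \<open>\<Inter>F\<close>, so their images
  meet trivially, while products equal to \<open>carrier G\<close> map onto the quotient.\<close>

lemma (in index_cover) transversal_partition_Mod:
  assumes Z: "\<Inter>F \<lhd> G" and proper: "carrier G \<notin> F"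
  shows "transversal_partition (G Mod \<Inter>F) ((`) ((#>) (\<Inter>F)) ` F)"
proof -
  interpret Z: normal "\<Inter>F" G by fact
  interpret Q: group "G Mod \<Inter>F" by (rule Z.factorgroup_is_group)
  interpret \<pi>: group_hom G "G Mod \<Inter>F" "(#>) (\<Inter>F)"
    by (intro group_hom.intro group_hom_axioms.intro group_axioms Q.group_axioms Z.r_coset_hom_Mod)
  have carrier_Q: "carrier (G Mod \<Inter>F) = (#>) (\<Inter>F) ` carrier G"
    by (auto simp: FactGroup_def RCOSETS_def)
  \<comment> \<open>Members contain \<open>\<Inter>F\<close> and are thus unions of its cosets, so
    membership can be tested on images.\<close>
  have mem: "x \<in> A" if "A \<in> F" "y \<in> A" "x \<in> carrier G" "\<Inter>F #> x = \<Inter>F #> y" for A x y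
  proof -
    have "x \<in> \<Inter>F #> y" using that rcos_self Z.subgroup_axioms by metis
    then obtain z where "z \<in> \<Inter>F" "x = z \<otimes> y" by (auto simp: r_coset_def)
    then show ?thesis using that sub subgroup.m_closed by fastforce
  qed
  show ?thesis
  proof (intro transversal_partition.intro transversal_partition_axioms.intro Q.group_axioms)
    show "finite (carrier (G Mod \<Inter>F))" using fin by (simp add: carrier_Q)
    show "\<Union> ((`) ((#>) (\<Inter>F)) ` F) = carrier (G Mod \<Inter>F)"
      unfolding carrier_Q cover[symmetric] by blast
    show "subgroup A (G Mod \<Inter>F)" if "A \<in> (`) ((#>) (\<Inter>F)) ` F" for A
      using that sub \<pi>.subgroup_img_is_subgroup by blast
    show "carrier (G Mod \<Inter>F) \<notin> (`) ((#>) (\<Inter>F)) ` F"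
    proof
      assume "carrier (G Mod \<Inter>F) \<in> (`) ((#>) (\<Inter>F)) ` F"
      then obtain A where A: "A \<in> F" "(#>) (\<Inter>F) ` carrier G = (#>) (\<Inter>F) ` A"
        by (auto simp: carrier_Q)
      have "carrier G \<subseteq> A"
      proof
        fix x assume x: "x \<in> carrier G"
        then obtain y where "y \<in> A" "\<Inter>F #> x = \<Inter>F #> y" using A(2) by blast
        then show "x \<in> A" using mem A(1) x by blast
      qed
      then have "A = carrier G" using subset_carrier A(1) by blast
      then show False using proper A(1) by blast
    qed
  next
    fix A' B'
    assume "A' \<in> (`) ((#>) (\<Inter>F)) ` F" "B' \<in> (`) ((#>) (\<Inter>F)) ` F" "A' \<noteq> B'"
    then obtain A B where AB: "A \<in> F" "B \<in> F" "A \<noteq> B"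
      and A': "A' = (#>) (\<Inter>F) ` A" and B': "B' = (#>) (\<Inter>F) ` B"
      by blast
    show "A' \<inter> B' = {\<one>\<^bsub>G Mod \<Inter>F\<^esub>}"
    proof (intro equalityI subsetI)
      fix q assume "q \<in> A' \<inter> B'"
      then obtain x y where xy: "x \<in> A" "y \<in> B" "q = \<Inter>F #> x" "\<Inter>F #> x = \<Inter>F #> y"
        by (auto simp: A' B')
      then have "x \<in> A \<inter> B" using mem AB subset_carrier by blast
      then have "x \<in> \<Inter>F" using inter_eq_Inter[OF AB] by blast
      then show "q \<in> {\<one>\<^bsub>G Mod \<Inter>F\<^esub>}"
        using xy coset_join2 Z.subgroup_axioms Z.subset by (auto simp: FactGroup_def)
    next
      fix q assume "q \<in> {\<one>\<^bsub>G Mod \<Inter>F\<^esub>}"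
      then have "q = \<Inter>F #> \<one>" using \<pi>.hom_one by simp
      then show "q \<in> A' \<inter> B'"
        using subgroup.one_closed[OF sub[OF AB(1)]] subgroup.one_closed[OF sub[OF AB(2)]]
        unfolding A' B' by blast
    qed
    have "(#>) (\<Inter>F) ` A <#>\<^bsub>G Mod \<Inter>F\<^esub> (#>) (\<Inter>F) ` B = (#>) (\<Inter>F) ` (A <#> B)"
      using AB subset_carrier by (simp add: \<pi>.image_set_mult)
    then show "A' <#>\<^bsub>G Mod \<Inter>F\<^esub> B' = carrier (G Mod \<Inter>F)"
      unfolding A' B' carrier_Q set_mult_eq_carrier[OF AB, symmetric] .
  qed
qed

text \<open>For two distinct members, \<open>order G\<close> is \<open>n * card A\<close>, and
  \<open>card A\<close> is \<open>n * card (A \<inter> B)\<close> with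
  \<open>A \<inter> B = \<Inter>F\<close>.\<close>

lemma (in index_cover) order_Mod_Inter:
  assumes "\<Inter>F \<lhd> G"
  shows "order (G Mod \<Inter>F) = n ^ 2"
proof -
  have "1 < card F" using card_F n_pos by simp
  then obtain A B where AB: "A \<in> F" "B \<in> F" "A \<noteq> B"
    by (metis card_le_Suc0_iff_eq finite_F not_less One_nat_def)
  have "n ^ 2 * card (\<Inter>F) = order G"
    using card_inter[OF AB] card_member[OF AB(1)] inter_eq_Inter[OF AB]
    by (simp add: power2_eq_square mult.assoc)
  moreover have "order (G Mod \<Inter>F) * card (\<Inter>F) = order G"
    using lagrange[OF normal_imp_subgroup[OF assms]] by (simp add: order_def FactGroup_def)
  moreover have "order G > 0" using fin order_gt_0_iff_finite by simp
  ultimately show ?thesis by (metis mult_cancel2 mult_0_right neq0_conv)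
qed

section \<open>Proper centralizers as a covering\<close>

theorem theorem3p19:
  fixes G :: "('a, 'b) monoid_scheme" and n :: nat
  assumes "group G"
    and "finite (carrier G)"
    and "n > 0"
    and "centralizer_group (n + 2) G"
    and "conjugate_type_1 n G"
  shows "CA_group G \<and> elementary_abelian (G Mod center G) \<and> order (G Mod center G) = n ^ 2"
proof -
  interpret group G by fact
  \<comment> \<open>The proper centralizers. \<open>Cent G\<close> has just one further member,
    \<open>carrier G\<close>, the centralizer of every central element; hence \<open>n + 2\<close>
    becomes \<open>n + 1\<close>.\<close>
  define F where "F = centralizer G ` (carrier G - center G)"
  have centralizer_eq_carrier: "centralizer G x = carrier G \<longleftrightarrow> x \<in> center G"
    if "x \<in> carrier G" for x
    using that unfolding centralizer_def center_def set_eq_iff mem_Collect_eq by metis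
  have "carrier G \<notin> F"
    using centralizer_eq_carrier by (auto simp: F_def)
  have "\<one>\<^bsub>G\<^esub> \<in> center G" by (auto simp: center_def)
  have center_subset: "center G \<subseteq> carrier G" by (auto simp: center_def)
  then have "centralizer G ` center G = (\<lambda>x. carrier G) ` center G"
    using centralizer_eq_carrier by (intro image_cong) blast+
  also have "\<dots> = {carrier G}" using \<open>\<one>\<^bsub>G\<^esub> \<in> center G\<close> by (rule image_constant)
  finally have "centralizer G ` center G = {carrier G}" .
  moreover have "Cent G = centralizer G ` center G \<union> F"
    using center_subset by (simp add: Cent_def F_def Un_absorb1 flip: image_Un)
  ultimately have "Cent G = insert (carrier G) F" by simp
  moreover have "finite F" using assms(2) by (simp add: F_def)
  ultimately have card_F: "card F = n + 1"
    using assms(4) \<open>carrier G \<notin> F\<close> by (simp add: centralizer_group_def)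
  then have "F \<noteq> {}" by auto
  have center: "\<Inter>F = center G"
  proof
    show "center G \<subseteq> \<Inter>F" by (auto simp: F_def center_def centralizer_def)
    show "\<Inter>F \<subseteq> center G"
    proof
      fix z assume z: "z \<in> \<Inter>F"
      then have "z \<in> carrier G" using \<open>F \<noteq> {}\<close> by (auto simp: F_def centralizer_def)
      moreover have "z \<otimes>\<^bsub>G\<^esub> x = x \<otimes>\<^bsub>G\<^esub> z" if "x \<in> carrier G" for x
      proof (cases "x \<in> center G")
        case True
        then show ?thesis using \<open>z \<in> carrier G\<close> by (simp add: center_def)
      next
        case False
        then show ?thesis using z that by (auto simp: F_def centralizer_def)
      qed
      ultimately show "z \<in> center G" by (simp add: center_def)
    qed
  qed
  interpret index_cover G F n
  proof (intro index_cover.intro index_cover_axioms.intro group_axioms)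
    show "\<Union>F = carrier G"
    proof
      show "\<Union>F \<subseteq> carrier G" by (auto simp: F_def centralizer_def)
      show "carrier G \<subseteq> \<Union>F"
      proof
        fix x assume x: "x \<in> carrier G"
        show "x \<in> \<Union>F"
        proof (cases "x \<in> center G")
          case True
          then show ?thesis using center \<open>F \<noteq> {}\<close> by blast
        next
          case False
          then have "centralizer G x \<in> F" "x \<in> centralizer G x"
            using x by (auto simp: F_def centralizer_def)
          then show ?thesis by blast
        qed
      qed
    qed
  qed (use assms card_F in \<open>auto simp: F_def conjugate_type_1_def subgroup_centralizer\<close>)
  have "comm_group (G\<lparr>carrier := centralizer G x\<rparr>)" if x: "x \<in> carrier G - center G" for x
  proof (rule group.group_comm_groupI)
    show "group (G\<lparr>carrier := centralizer G x\<rparr>)"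
      using x subgroup_centralizer subgroup_imp_group by blast
    fix y z
    assume "y \<in> carrier (G\<lparr>carrier := centralizer G x\<rparr>)" "z \<in> carrier (G\<lparr>carrier := centralizer G x\<rparr>)"
    then have yz: "y \<in> centralizer G x" "z \<in> centralizer G x" by auto
    then have "y \<in> carrier G" "z \<in> carrier G" by (auto simp: centralizer_def)
    have "z \<in> centralizer G y"
    proof (cases "y \<in> center G")
      case True
      then show ?thesis using \<open>y \<in> carrier G\<close> \<open>z \<in> carrier G\<close> centralizer_eq_carrier by blast
    next
      case False
      \<comment> \<open>The noncentral \<open>y\<close> lies in its own centralizer and in that of
        \<open>x\<close>; distinct members share only central elements, so the two coincide and
        contain \<open>z\<close>.\<close>
      then have "centralizer G x \<in> F" "centralizer G y \<in> F"
        using x \<open>y \<in> carrier G\<close> by (auto simp: F_def)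
      moreover have "y \<in> centralizer G x \<inter> centralizer G y" "y \<notin> \<Inter>F"
        using yz \<open>y \<in> carrier G\<close> False center by (auto simp: centralizer_def)
      ultimately have "centralizer G x = centralizer G y"
        using inter_eq_Inter by blast
      then show ?thesis using yz by simp
    qed
    then show "y \<otimes>\<^bsub>G\<lparr>carrier := centralizer G x\<rparr>\<^esub> z = z \<otimes>\<^bsub>G\<lparr>carrier := centralizer G x\<rparr>\<^esub> y"
      by (simp add: centralizer_def)
  qed
  then have "CA_group G" by (simp add: CA_group_def is_group)
  moreover have "elementary_abelian (G Mod center G)"
    using transversal_partition.is_elementary_abelian[OF transversal_partition_Mod]
      normal_center \<open>carrier G \<notin> F\<close> by (simp add: center)
  moreover have "order (G Mod center G) = n ^ 2"
    using order_Mod_Inter normal_center by (simp add: center)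
  ultimately show ?thesis by blast
qed

end
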